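(* Let $\mathcal{M}=((X,\tau),\nu)$ be a topological model and let $\varphi$ be a modal formula. Then for every $x\in X$: $$x\models \Diamond_{\mathrm{ns}}\varphi \iff x\in\omega(\llbracket\varphi\rrbracket^{\mathcal{M}}),$$ where $\omega(A)$ denotes the set of $\omega$-accumulation points of $A\subseteq X$.
   Context: Nonstandard setting. For a topological space $(X,\tau)$ let $S=X\cup\mathbb{R}$ and let $V(S)=\bigcup_{k\in\mathbb{N}_0}V_k(S)$ be the superstructure over $S$, where $V_0(S)=S$ and $V_{k+1}(S)=V_k(S)\cup\mathcal{P}(V_k(S))$. A polysaturated nonstandard model is a superstructure $V({}^*S)$ with a star map $A\mapsto{}^*A$ from $V(S)$ to $V({}^*S)$ such that: (1) Extension: ${}^*s=s$ for all $s\in S$; (2) Transfer: a bounded quantifier formula $\Phi(A_1,\dots,A_n)$ is true in $V(S)$ iff $\Phi({}^*A_1,\dots,{}^*A_n)$ is true in $V({}^*S)$; (3) Saturation: every family of internal sets of cardinality at most $\kappa$ with the finite intersection property has non-empty intersection, where $\kappa\ge|V(S)|$ is a fixed cardinal. A set is internal if it is an element of ${}^*C$ for some $C\in V(S)$. One such model is fixed throughout. In particular $X\subseteq{}^*X$. Halo. For $x\in X$, $\mathcal{N}(x)=\{U\in\tau: x\in U\}$ and $\mu(x)=\bigcap_{U\in\mathcal{N}(x)}{}^*U$. Modal semantics. Formulas are built from propositional variables, $\bot$, $\neg$, $\wedge$ and a unary $\Diamond_{\mathrm{ns}}$. A topological model is $\mathcal{M}=((X,\tau),\nu)$ with $(X,\tau)$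 a topological space and $\nu$ a map from propositional variables to $\mathcal{P}(X)$. The extension $\llbracket\varphi\rrbracket^{\mathcal{M}}\subseteq X$ is defined with $\llbracket p\rrbracket=\nu(p)$, Boolean clauses as usual, and $\llbracket\Diamond_{\mathrm{ns}}\varphi\rrbracket=\{x\in X:\mu(x)\cap({}^*\llbracket\varphi\rrbracket\setminus X)\neq\emptyset\}$. Write $x\models\varphi$ for $x\in\llbracket\varphi\rrbracket$. A point $x\in X$ is an $\omega$-accumulation point of $A\subseteq X$ if $|U\cap A|\ge\aleph_0$ for every open set $U$ containing $x$. *)

theory Defs
  imports "HOL-Analysis.Abstract_Topology"
begin

unbundle cardinal_syntax

text \<open>
  A superstructure over an infinite set has the cardinality of the union of all its finite
  iterated power sets, and no type constructor of HOL yields a type of that size uniformly.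
  The ambient universe of sets and atoms (urelements) is therefore an abstract type: every
  member of the type is an atom or an extensional set.  Fullness of the power sets, which makes
  the hierarchies below genuine superstructures, is imposed by \<open>superstructure_base\<close>.
\<close>

class set_universe =
  fixes elts :: "'a \<Rightarrow> 'a set"
    and atoms :: "'a set"
  assumes elts_atom: "a \<in> atoms \<Longrightarrow> elts a = {}"
    and extensionality: "a \<notin> atoms \<Longrightarrow> b \<notin> atoms \<Longrightarrow> elts a = elts b \<Longrightarrow> a = b"

text \<open>The unique set of the universe with the given elements, where there is one.\<close>

definition set_of :: "'u::set_universe set \<Rightarrow> 'u" where
  "set_of A = (THE a. a \<notin> atoms \<and> elts a = A)"

primrec level :: "'u::set_universe set \<Rightarrow> nat \<Rightarrow> 'u set" where
  "level S 0 = S"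
| "level S (Suc k) = level S k \<union> {a. a \<notin> atoms \<and> elts a \<subseteq> level S k}"

definition superstructure :: "'u::set_universe set \<Rightarrow> 'u set" where
  "superstructure S = (\<Union>k. level S k)"

text \<open>\<open>S\<close> consists of atoms, and the universe contains every subset of every \<open>level S k\<close>, so that
  \<open>level S (Suc k)\<close> adds the full power set of \<open>level S k\<close>.\<close>

definition superstructure_base :: "'u::set_universe set \<Rightarrow> bool" where
  "superstructure_base S \<longleftrightarrow>
     S \<subseteq> atoms \<and> (\<forall>k. \<forall>A \<subseteq> level S k. \<exists>a. a \<notin> atoms \<and> elts a = A)"

text \<open>Bounded quantifier formulas with variables \<open>x\<^sub>0, x\<^sub>1, \<dots>\<close>; \<open>BAll i j \<Phi>\<close> is
  \<open>\<forall>x\<^sub>i \<in> x\<^sub>j. \<Phi>\<close>, where \<open>x\<^sub>j\<close> is read outside the scope of the quantifier.  The parameters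
  \<open>A\<^sub>1, \<dots>, A\<^sub>n\<close> are the values of the free variables.\<close>

datatype bformula =
    FEq nat nat
  | FMem nat nat
  | FNeg bformula
  | FConj bformula bformula
  | FDisj bformula bformula
  | FImp bformula bformula
  | BAll nat nat bformula
  | BEx nat nat bformula

primrec true_in :: "'u::set_universe set \<Rightarrow> (nat \<Rightarrow> 'u) \<Rightarrow> bformula \<Rightarrow> bool" where
  "true_in V e (FEq i j) \<longleftrightarrow> e i = e j"
| "true_in V e (FMem i j) \<longleftrightarrow> e i \<in> elts (e j)"
| "true_in V e (FNeg \<Phi>) \<longleftrightarrow> \<not> true_in V e \<Phi>"
| "true_in V e (FConj \<Phi> \<Psi>) \<longleftrightarrow> true_in V e \<Phi> \<and> true_in V e \<Psi>"
| "true_in V e (FDisj \<Phi> \<Psi>) \<longleftrightarrow> true_in V e \<Phi> \<or> true_in V e \<Psi>"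
| "true_in V e (FImp \<Phi> \<Psi>) \<longleftrightarrow> (true_in V e \<Phi> \<longrightarrow> true_in V e \<Psi>)"
| "true_in V e (BAll i j \<Phi>) \<longleftrightarrow> (\<forall>a\<in>V. a \<in> elts (e j) \<longrightarrow> true_in V (e(i := a)) \<Phi>)"
| "true_in V e (BEx i j \<Phi>) \<longleftrightarrow> (\<exists>a\<in>V. a \<in> elts (e j) \<and> true_in V (e(i := a)) \<Phi>)"

text \<open>For a set \<open>A\<close> of members of the universe, \<open>star_set star A\<close> is the set of elements of
  \<open>\<^sup>*A\<close>.\<close>

definition star_set :: "('u::set_universe \<Rightarrow> 'u) \<Rightarrow> 'u set \<Rightarrow> 'u set" where
  "star_set star A = elts (star (set_of A))"

definition internal_set :: "'u::set_universe set \<Rightarrow> ('u \<Rightarrow> 'u) \<Rightarrow> 'u \<Rightarrow> bool" where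
  "internal_set S star a \<longleftrightarrow> a \<notin> atoms \<and> (\<exists>C\<in>superstructure S. a \<in> elts (star C))"

text \<open>Both superstructures live in the same universe, so \<open>\<^sup>*s = s\<close> is a literal equation.  Only
  the values of \<open>star\<close> on \<open>superstructure S\<close> matter.  In \<open>saturation\<close> the empty family is
  harmless, since \<open>\<Inter>{} = UNIV\<close>.\<close>

locale polysaturated_model =
  fixes S :: "'u::set_universe set"
    and star :: "'u \<Rightarrow> 'u"
    and \<kappa> :: "'k rel"
  assumes standard_base: "superstructure_base S"
    and nonstandard_base: "superstructure_base (star_set star S)"
    and star_closed:
      "A \<in> superstructure S \<Longrightarrow> star A \<in> superstructure (star_set star S)"
    and extension: "s \<in> S \<Longrightarrow> star s = s"
    and transfer: "(\<And>i. e i \<in> superstructure S) \<Longrightarrow>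
      true_in (superstructure S) e \<Phi> \<longleftrightarrow>
      true_in (superstructure (star_set star S)) (\<lambda>i. star (e i)) \<Phi>"
    and cardinal: "Card_order \<kappa>" "|superstructure S| \<le>o \<kappa>"
    and saturation: "(\<And>a. a \<in> F \<Longrightarrow> internal_set S star a) \<Longrightarrow> |F| \<le>o \<kappa> \<Longrightarrow>
      (\<And>G. G \<subseteq> F \<Longrightarrow> finite G \<Longrightarrow> (\<Inter>a\<in>G. elts a) \<noteq> {}) \<Longrightarrow>
      (\<Inter>a\<in>F. elts a) \<noteq> {}"

definition halo :: "('u::set_universe \<Rightarrow> 'u) \<Rightarrow> 'u topology \<Rightarrow> 'u \<Rightarrow> 'u set" where
  "halo star T x = (\<Inter>U\<in>{U. openin T U \<and> x \<in> U}. star_set star U)"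

datatype 'p formula =
    Var 'p
  | Falsum
  | Neg "'p formula"
  | Conj "'p formula" "'p formula"
  | Dia_ns "'p formula"

primrec extent ::
  "('u::set_universe \<Rightarrow> 'u) \<Rightarrow> 'u topology \<Rightarrow> ('p \<Rightarrow> 'u set) \<Rightarrow> 'p formula \<Rightarrow> 'u set" where
  "extent star T \<nu> (Var p) = \<nu> p"
| "extent star T \<nu> Falsum = {}"
| "extent star T \<nu> (Neg \<phi>) = topspace T - extent star T \<nu> \<phi>"
| "extent star T \<nu> (Conj \<phi> \<psi>) = extent star T \<nu> \<phi> \<inter> extent star T \<nu> \<psi>"
| "extent star T \<nu> (Dia_ns \<phi>) =
     {x \<in> topspace T. halo star T x \<inter> (star_set star (extent star T \<nu> \<phi>) - topspace T) \<noteq> {}}"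

definition models ::
  "('u::set_universe \<Rightarrow> 'u) \<Rightarrow> 'u topology \<Rightarrow> ('p \<Rightarrow> 'u set) \<Rightarrow> 'u \<Rightarrow> 'p formula \<Rightarrow> bool" where
  "models star T \<nu> x \<phi> \<longleftrightarrow> x \<in> extent star T \<nu> \<phi>"

definition omega_accumulation_points :: "'a topology \<Rightarrow> 'a set \<Rightarrow> 'a set" where
  "omega_accumulation_points T A =
     {x \<in> topspace T. \<forall>U. openin T U \<and> x \<in> U \<longrightarrow> infinite (U \<inter> A)}"

end

theory Submission
  imports Defs
begin

text \<open>
  Write \<open>A\<close> for the extension of \<open>\<phi>\<close>, a set of standard points.

  If \<open>y\<close> is a nonstandard point of \<open>\<^sup>*A\<close> in the halo of \<open>x\<close>, then for every open neighbourhood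
  \<open>U\<close> of \<open>x\<close> it lies in \<open>\<^sup>*U \<inter> \<^sup>*A = \<^sup>*(U \<inter> A)\<close>.  The star of a finite set of standard points
  contains no new points (\<open>star_set_finite_subset\<close>), so \<open>U \<inter> A\<close> must be infinite.

  Conversely, let \<open>x\<close> be an \<open>\<omega>\<close>-accumulation point of \<open>A\<close>.  A nonstandard point of \<open>\<^sup>*A\<close> in the
  halo of \<open>x\<close> is a common element of the internal sets \<open>\<^sup>*(U \<inter> A - {a})\<close>, where \<open>U\<close> ranges over the
  open neighbourhoods of \<open>x\<close> and \<open>a\<close> over the standard points: the factor \<open>U\<close> places it in the
  halo, and omitting \<open>a\<close> makes it different from \<open>a\<close>.  Finitely many of these sets share a
  standard point, because the finite intersection of the neighbourhoods meets \<open>A\<close> in an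
  infinite set and only finitely many points are omitted.  There are at most as many of them as
  there are standard sets, so saturation applies, in the form of \<open>star_sets_common_point\<close>.
\<close>

section \<open>Sets of points in the superstructure\<close>

lemma set_of_eqI:
  assumes "a \<notin> atoms" "elts a = A"
  shows "set_of A = a"
  unfolding set_of_def using assms extensionality by (intro the_equality) auto

lemma level_subset_superstructure: "level S k \<subseteq> superstructure S"
  unfolding superstructure_def by blast

text \<open>A superstructure over a set of atoms is transitive.  Hence the quantifiers of a bounded
  formula, restricted as they are to the superstructure, range over all elements of the
  bounding set.\<close>

lemma elts_subset_superstructure:
  assumes "S \<subseteq> atoms" "a \<in> superstructure S"
  shows "elts a \<subseteq> superstructure S"
proof -
  have "a \<in> level S k \<Longrightarrow> elts a \<subseteq> superstructure S" for k
  proof (induction k)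
    case 0
    then show ?case using assms(1) elts_atom by auto
  next
    case (Suc k)
    then show ?case using level_subset_superstructure[of S k] by auto
  qed
  then show ?thesis using assms(2) by (auto simp: superstructure_def)
qed

context polysaturated_model
begin

lemma set_of_level:
  assumes "A \<subseteq> level S k"
  shows "set_of A \<notin> atoms" "elts (set_of A) = A" "set_of A \<in> level S (Suc k)"
proof -
  obtain a where a: "a \<notin> atoms" "elts a = A"
    using standard_base assms unfolding superstructure_base_def by metis
  then have "set_of A = a" by (rule set_of_eqI)
  then show "set_of A \<notin> atoms" "elts (set_of A) = A" "set_of A \<in> level S (Suc k)"
    using a assms by auto
qed

lemma set_of_points:
  assumes "A \<subseteq> S"
  shows "set_of A \<in> superstructure S" "elts (set_of A) = A"
  using set_of_level[of A 0] assms level_subset_superstructure[of S "Suc 0"]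
  by (auto simp del: level.simps(2))

lemma point_in_superstructure: "s \<in> S \<Longrightarrow> s \<in> superstructure S"
  using level_subset_superstructure[of S 0] by auto

lemma elts_star_in_superstructure:
  "a \<in> superstructure S \<Longrightarrow> z \<in> elts (star a) \<Longrightarrow> z \<in> superstructure (star_set star S)"
  using elts_subset_superstructure nonstandard_base star_closed
  by (auto simp: superstructure_base_def)

section \<open>Transfer of elementary set relations\<close>

text \<open>The parameters are read as the variables \<open>1\<close>, \<open>2\<close>, \<open>3\<close>; variable \<open>0\<close> is reserved for a
  quantifier.\<close>

lemma transfer3:
  fixes a b c :: 'u
  defines "e \<equiv> (\<lambda>i::nat. if i \<le> 1 then a else if i = 2 then b else c)"
  assumes "a \<in> superstructure S" "b \<in> superstructure S" "c \<in> superstructure S"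
  shows "true_in (superstructure S) e \<Phi> \<longleftrightarrow>
    true_in (superstructure (star_set star S)) (\<lambda>i. star (e i)) \<Phi>"
  using assms by (intro transfer) auto

lemma star_mem_iff:
  assumes "a \<in> superstructure S" "b \<in> superstructure S"
  shows "star a \<in> elts (star b) \<longleftrightarrow> a \<in> elts b"
  using transfer3[OF assms assms(2), of "FMem 1 2"] by simp

lemma star_inter_subset:
  assumes V: "a \<in> superstructure S" "b \<in> superstructure S" "c \<in> superstructure S"
    and "elts a \<inter> elts b \<subseteq> elts c"
  shows "elts (star a) \<inter> elts (star b) \<subseteq> elts (star c)"
  using transfer3[OF V, of "BAll 0 1 (FImp (FMem 0 2) (FMem 0 3))"] assms
  by (auto dest: elts_star_in_superstructure)

lemma star_subset_insert:
  assumes V: "a \<in> superstructure S" "b \<in> superstructure S" "c \<in> superstructure S"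
    and "elts a \<subseteq> insert b (elts c)"
  shows "elts (star a) \<subseteq> insert (star b) (elts (star c))"
  using transfer3[OF V, of "BAll 0 1 (FDisj (FEq 0 2) (FMem 0 3))"] assms
  by (auto dest: elts_star_in_superstructure)

lemma star_no_elements:
  assumes "a \<in> superstructure S" "elts a = {}"
  shows "elts (star a) = {}"
  using transfer3[OF assms(1) assms(1) assms(1), of "BAll 0 1 (FNeg (FEq 0 0))"] assms
  by (auto dest: elts_star_in_superstructure)

lemma point_in_star_set_iff:
  assumes "s \<in> S" "A \<subseteq> S"
  shows "s \<in> star_set star A \<longleftrightarrow> s \<in> A"
  using star_mem_iff[of s "set_of A"] assms set_of_points[of A] point_in_superstructure
    extension by (simp add: star_set_def)

lemma star_set_inter_subset:
  assumes "A \<subseteq> S" "B \<subseteq> S"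
  shows "star_set star A \<inter> star_set star B \<subseteq> star_set star (A \<inter> B)"
proof -
  have "A \<inter> B \<subseteq> S" using assms by blast
  then show ?thesis unfolding star_set_def
    using assms by (intro star_inter_subset) (simp_all add: set_of_points)
qed

lemma star_set_mono:
  assumes "A \<subseteq> B" "B \<subseteq> S"
  shows "star_set star A \<subseteq> star_set star B"
proof -
  have "A \<subseteq> S" using assms by blast
  then show ?thesis
    using star_inter_subset[of "set_of A" "set_of A" "set_of B"] assms
    by (simp add: set_of_points star_set_def)
qed

text \<open>Adjoining a point \<open>s\<close> to \<open>A\<close> adjoins only \<open>\<^sup>*s = s\<close> to \<open>\<^sup>*A\<close>, and \<open>\<^sup>*{}\<close> is empty; so a
  finite set of points acquires no nonstandard elements.\<close>

lemma star_set_finite_subset: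
  assumes "finite A" "A \<subseteq> S"
  shows "star_set star A \<subseteq> A"
  using assms
proof (induction A rule: finite_induct)
  case empty
  then show ?case using star_no_elements[of "set_of {}"] set_of_points[of "{}"]
    by (simp add: star_set_def)
next
  case (insert s A)
  have "star_set star (insert s A) \<subseteq> insert (star s) (star_set star A)"
    unfolding star_set_def using insert.prems
    by (intro star_subset_insert) (simp_all add: set_of_points point_in_superstructure)
  then show ?case using insert extension by auto
qed

section \<open>Saturation for stars of sets of points\<close>

text \<open>The set \<open>\<^sup>*A\<close> is internal because it is an element of the star of the power set of \<open>S\<close>.
  Nonemptiness excludes that \<open>\<^sup>*A\<close> is an atom, since an atom has no elements.\<close>

lemma star_set_internal:
  assumes "A \<subseteq> S" "A \<noteq> {}"
  shows "internal_set S star (star (set_of A))"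
proof -
  define P where "P = set_of (set_of ` Pow S)"
  have "set_of ` Pow S \<subseteq> level S (Suc 0)"
    using set_of_level(3)[of _ 0] by (auto simp del: level.simps(2))
  from set_of_level[OF this] have P: "P \<in> superstructure S" "elts P = set_of ` Pow S"
    unfolding P_def using level_subset_superstructure by blast+
  have "star (set_of A) \<in> elts (star P)"
    using star_mem_iff P set_of_points(1)[OF assms(1)] assms(1) by simp
  moreover have "star (set_of A) \<notin> atoms"
    using assms point_in_star_set_iff[OF _ assms(1)] elts_atom[of "star (set_of A)"]
    by (auto simp: star_set_def)
  ultimately show ?thesis using P(1) by (auto simp: internal_set_def)
qed

text \<open>Such a family of stars is contained in the image of the standard superstructure under
  \<open>star\<close>, so it is small enough for saturation.  Its finite intersections are nonempty because
  a common point of finitely many members of \<open>\<A>\<close> is a common point of their stars.\<close>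

lemma star_sets_common_point:
  assumes "\<And>A. A \<in> \<A> \<Longrightarrow> A \<subseteq> S"
    and fip: "\<And>\<B>. \<B> \<subseteq> \<A> \<Longrightarrow> finite \<B> \<Longrightarrow> S \<inter> \<Inter>\<B> \<noteq> {}"
  shows "(\<Inter>A\<in>\<A>. star_set star A) \<noteq> {}"
proof -
  define F where "F = (\<lambda>A. star (set_of A)) ` \<A>"
  have "(\<Inter>a\<in>F. elts a) \<noteq> {}"
  proof (rule saturation)
    fix a assume "a \<in> F"
    then obtain A where "A \<in> \<A>" "a = star (set_of A)" by (auto simp: F_def)
    then show "internal_set S star a"
      using star_set_internal[of A] assms(1) fip[of "{A}"] by auto
  next
    have "F \<subseteq> star ` superstructure S"
      using assms(1) set_of_points by (auto simp: F_def)
    then have "|F| \<le>o |star ` superstructure S|" by (rule card_of_mono1)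
    also have "|star ` superstructure S| \<le>o |superstructure S|" by (rule card_of_image)
    finally show "|F| \<le>o \<kappa>" using cardinal(2) ordLeq_transitive by blast
  next
    fix G assume "G \<subseteq> F" "finite G"
    then obtain \<B> where B: "\<B> \<subseteq> \<A>" "finite \<B>" "G = (\<lambda>A. star (set_of A)) ` \<B>"
      unfolding F_def by (meson finite_subset_image)
    then obtain s where s: "s \<in> S" "s \<in> \<Inter>\<B>" using fip[of \<B>] by auto
    have "s \<in> star_set star A" if "A \<in> \<B>" for A
      using that B(1) s assms(1) point_in_star_set_iff[of s A] by auto
    then show "(\<Inter>a\<in>G. elts a) \<noteq> {}" unfolding B(3) star_set_def by blast
  qed
  then show ?thesis by (simp add: F_def star_set_def)
qed

section \<open>Nonstandard points in halos\<close>

lemma halo_meets_imp_omega_accumulation: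
  assumes "topspace T \<subseteq> S" "A \<subseteq> topspace T" "x \<in> topspace T"
    and y: "y \<in> halo star T x" "y \<in> star_set star A" "y \<notin> topspace T"
  shows "x \<in> omega_accumulation_points T A"
proof -
  have "infinite (U \<inter> A)" if U: "openin T U" "x \<in> U" for U
  proof
    assume fin: "finite (U \<inter> A)"
    have "U \<subseteq> topspace T" using U by (simp add: openin_subset)
    then have sub: "U \<subseteq> S" "A \<subseteq> S" "U \<inter> A \<subseteq> S" using assms by auto
    have "y \<in> star_set star (U \<inter> A)"
      using star_set_inter_subset[OF sub(1,2)] y U by (auto simp: halo_def)
    then have "y \<in> A" using star_set_finite_subset[OF fin sub(3)] by blast
    then show False using y assms by blast
  qed
  then show ?thesis using assms by (simp add: omega_accumulation_points_def)
qed

lemma omega_accumulation_imp_halo_meets: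
  assumes X: "topspace T \<subseteq> S" and A: "A \<subseteq> topspace T"
    and x: "x \<in> omega_accumulation_points T A"
  shows "halo star T x \<inter> (star_set star A - topspace T) \<noteq> {}"
proof -
  define N where "N = {U. openin T U \<and> x \<in> U}"
  define B where "B = (\<lambda>(U, a). U \<inter> A - {a})"
  have xX: "x \<in> topspace T" and inf: "\<And>U. U \<in> N \<Longrightarrow> infinite (U \<inter> A)"
    using x by (auto simp: omega_accumulation_points_def N_def)
  then have XN: "topspace T \<in> N" by (simp add: N_def)
  have "(\<Inter>C \<in> B ` (N \<times> topspace T). star_set star C) \<noteq> {}"
  proof (rule star_sets_common_point)
    show "C \<subseteq> S" if "C \<in> B ` (N \<times> topspace T)" for C
      using that X A by (auto simp: B_def)
  next
    fix \<B> assume "\<B> \<subseteq> B ` (N \<times> topspace T)" "finite \<B>"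
    then obtain I where I: "I \<subseteq> N \<times> topspace T" "finite I" "\<B> = B ` I"
      by (meson finite_subset_image)
    \<comment> \<open>Including the whole space keeps the intersection of neighbourhoods open when \<open>I\<close> is
      empty.\<close>
    define W where "W = \<Inter>(insert (topspace T) (fst ` I))"
    have "openin T W" unfolding W_def using I by (intro openin_Inter) (auto simp: N_def)
    moreover have "x \<in> W" using I xX by (auto simp: W_def N_def)
    ultimately have "infinite (W \<inter> A)" using inf by (simp add: N_def)
    then have "infinite (W \<inter> A - snd ` I)" using I(2) by simp
    then obtain s where "s \<in> W \<inter> A - snd ` I" using infinite_imp_nonempty by blast
    then have "s \<in> S \<inter> \<Inter>\<B>" using X A by (force simp: I(3) B_def W_def)
    then show "S \<inter> \<Inter>\<B> \<noteq> {}" by blast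
  qed
  then obtain y where y: "\<And>U a. U \<in> N \<Longrightarrow> a \<in> topspace T \<Longrightarrow> y \<in> star_set star (U \<inter> A - {a})"
    unfolding B_def by fastforce
  have "y \<in> star_set star U" if U: "U \<in> N" for U
  proof -
    have "U \<subseteq> S" using U X openin_subset[of T U] by (auto simp: N_def)
    then show ?thesis using star_set_mono[of "U \<inter> A - {x}" U] y[OF U xX] by blast
  qed
  then have "y \<in> halo star T x" by (simp add: halo_def N_def)
  moreover have "y \<in> star_set star A"
    using star_set_mono[of "topspace T \<inter> A - {x}" A] y[OF XN xX] X A by blast
  moreover have "y \<notin> topspace T"
  proof
    assume yX: "y \<in> topspace T"
    have "topspace T \<inter> A - {y} \<subseteq> S" using X by blast
    then show False
      using y[OF XN yX] point_in_star_set_iff[of y "topspace T \<inter> A - {y}"] yX X by blast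
  qed
  ultimately show ?thesis by blast
qed

end

lemma extent_subset_topspace:
  assumes "\<And>p. \<nu> p \<subseteq> topspace T"
  shows "extent star T \<nu> \<phi> \<subseteq> topspace T"
  using assms by (induction \<phi>) auto

theorem theorem6p4:
  fixes T :: "'u::set_universe topology"
    and real_atom :: "real \<Rightarrow> 'u"
    and star :: "'u \<Rightarrow> 'u"
    and \<kappa> :: "'k rel"
    and \<nu> :: "'p \<Rightarrow> 'u set"
    and \<phi> :: "'p formula"
    and x :: 'u
  assumes "inj real_atom"
    and "polysaturated_model (topspace T \<union> range real_atom) star \<kappa>"
    and "\<And>p. \<nu> p \<subseteq> topspace T"
    and "x \<in> topspace T"
  shows "models star T \<nu> x (Dia_ns \<phi>) \<longleftrightarrow>
         x \<in> omega_accumulation_points T (extent star T \<nu> \<phi>)"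
proof -
  interpret polysaturated_model "topspace T \<union> range real_atom" star \<kappa> by fact
  have A: "extent star T \<nu> \<phi> \<subseteq> topspace T"
    using assms(3) by (rule extent_subset_topspace)
  show ?thesis
  proof
    assume "models star T \<nu> x (Dia_ns \<phi>)"
    then obtain y where "y \<in> halo star T x" "y \<in> star_set star (extent star T \<nu> \<phi>)"
      "y \<notin> topspace T" by (auto simp: models_def)
    then show "x \<in> omega_accumulation_points T (extent star T \<nu> \<phi>)"
      using halo_meets_imp_omega_accumulation[OF _ A assms(4)] by blast
  next
    assume "x \<in> omega_accumulation_points T (extent star T \<nu> \<phi>)"
    then show "models star T \<nu> x (Dia_ns \<phi>)"
      using omega_accumulation_imp_halo_meets[OF _ A] assms(4) by (simp add: models_def)
  qed
qed

end
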